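(* There exists a Tychonoff space $X$ such that $C_p(X)$ and $B_1(X)$ are sequentially separable, but $USC_p^f(X)$ is not sequentially separable.
   Context: A topological space $Z$ is sequentially separable if it has a countable subset $D$ such that every point of $Z$ is the limit of a sequence of elements of $D$. $C_p(X)$ is the set of continuous real-valued functions on $X$ with the topology of pointwise convergence; $B_1(X)$ is the set of pointwise limits of sequences of continuous real-valued functions on $X$ with the topology of pointwise convergence. A cozero-set of $X$ is a set of the form $\{x: g(x)\neq 0\}$ with $g$ continuous real-valued on $X$. $USC^f(X)=\{f\in\mathbb{R}^X : f^{-1}((-\infty,r)) \text{ is a cozero-set of } X \text{ for every } r\in\mathbb{R}\}$, and $USC_p^f(X)$ is this set with the topology of pointwise convergence. *)

theory Defs
  imports "HOL-Analysis.Analysis"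
begin

definition Tychonoff_space :: "'a topology \<Rightarrow> bool" where
  "Tychonoff_space X \<longleftrightarrow> completely_regular_space X \<and> Hausdorff_space X"

definition seq_separable :: "'b topology \<Rightarrow> bool" where
  "seq_separable Z \<longleftrightarrow>
     (\<exists>D. D \<subseteq> topspace Z \<and> countable D \<and>
        (\<forall>z\<in>topspace Z. \<exists>s::nat \<Rightarrow> 'b. (\<forall>n. s n \<in> D) \<and> limitin Z s z sequentially))"

text \<open>Real-valued functions on X are represented as extensional functions on topspace X
  (value undefined outside); R^X with pointwise convergence is the product topology.\<close>
definition pointwise_top :: "'a topology \<Rightarrow> ('a \<Rightarrow> real) set \<Rightarrow> ('a \<Rightarrow> real) topology" where
  "pointwise_top X F = subtopology (product_topology (\<lambda>_. euclideanreal) (topspace X)) F"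

definition Cp :: "'a topology \<Rightarrow> ('a \<Rightarrow> real) topology" where
  "Cp X = pointwise_top X
     {f. f \<in> extensional (topspace X) \<and> continuous_map X euclideanreal f}"

definition B1 :: "'a topology \<Rightarrow> ('a \<Rightarrow> real) topology" where
  "B1 X = pointwise_top X
     {f. f \<in> extensional (topspace X) \<and>
         (\<exists>g::nat \<Rightarrow> 'a \<Rightarrow> real. (\<forall>n. continuous_map X euclideanreal (g n)) \<and>
            (\<forall>x\<in>topspace X. (\<lambda>n. g n x) \<longlonglongrightarrow> f x))}"

definition cozero_set :: "'a topology \<Rightarrow> 'a set \<Rightarrow> bool" where
  "cozero_set X U \<longleftrightarrow>
     (\<exists>g. continuous_map X euclideanreal g \<and> U = {x \<in> topspace X. g x \<noteq> 0})"

definition USCf_p :: "'a topology \<Rightarrow> ('a \<Rightarrow> real) topology" where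
  "USCf_p X = pointwise_top X
     {f. f \<in> extensional (topspace X) \<and>
         (\<forall>r::real. cozero_set X {x \<in> topspace X. f x < r})}"

end

theory Submission
  imports Defs
begin

text \<open>Refine the topology of the plane by making the functions
  \<open>\<bar>y - q\<bar> / (\<bar>x - p\<bar> + \<bar>y - q\<bar>)\<close> continuous, for all real \<open>p\<close> and rational \<open>q\<close>; the
  double cones \<open>\<bar>y - q\<bar> < \<delta> \<bar>x - p\<bar>\<close>, together with their vertex and cut off by a ball, then form a
  neighbourhood base at \<open>(p, q)\<close>. The new open sets are \<open>F\<^sub>\<sigma>\<close> in the plane, and on each
  rational horizontal line and on the set of points with irrational ordinate the topology is
  unchanged. By the Lebesgue--Hausdorff theorem, continuous functions are
  therefore pointwise limits of rational polynomials, and functions of the first Baire class are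
  limits of rational polynomials modified on finitely many rational horizontal lines.

  On the other hand, a single open set differs from its Euclidean interior only at countably many
  points, so countably many functions in \<open>USC\<^sup>f\<close> do not see the new open sets along the vertical
  line \<open>x = p\<close>, for some \<open>p\<close>. But the irrational points of this line form a zero-set, whose
  indicator is in \<open>USC\<^sup>f\<close>; approximating it would make the rationals a \<open>G\<^sub>\<delta>\<close> subset of the line.\<close>

section \<open>Pointwise limits of continuous functions\<close>

text \<open>Convergence in a subspace of a product is coordinatewise. Extensionality of
  \<open>F\<close> ensures that intersecting with the carrier of the product loses no
  function.\<close>

lemma seq_separable_pointwise_topI:
  assumes "D \<subseteq> F" "countable D" "F \<subseteq> extensional (topspace X)"
    and "\<And>f. f \<in> F \<Longrightarrow> \<exists>s. (\<forall>n::nat. s n \<in> D) \<and> (\<forall>x\<in>topspace X. (\<lambda>n. s n x) \<longlonglongrightarrow> f x)"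
  shows "seq_separable (pointwise_top X F)"
proof -
  have top: "topspace (pointwise_top X F) = F"
    using assms(3) by (auto simp: pointwise_top_def PiE_def)
  have "limitin (pointwise_top X F) s f sequentially"
    if "f \<in> F" "\<forall>n. s n \<in> D" "\<forall>x\<in>topspace X. (\<lambda>n. s n x) \<longlonglongrightarrow> f x" for f and s :: "nat \<Rightarrow> _"
    using that assms(1,3)
    by (auto simp: pointwise_top_def limitin_subtopology limitin_componentwise PiE_def
             intro!: always_eventually)
  then show ?thesis
    unfolding seq_separable_def top using assms by metis
qed

lemma seq_separable_pointwise_topD:
  assumes "seq_separable (pointwise_top X F)" "F \<subseteq> extensional (topspace X)"
  obtains D where "D \<subseteq> F" "countable D"
    "\<And>f. f \<in> F \<Longrightarrow> \<exists>s. (\<forall>n::nat. s n \<in> D) \<and> (\<forall>x\<in>topspace X. (\<lambda>n. s n x) \<longlonglongrightarrow> f x)"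
proof -
  have top: "topspace (pointwise_top X F) = F"
    using assms(2) by (auto simp: pointwise_top_def PiE_def)
  have "\<forall>x\<in>topspace X. (\<lambda>n. s n x) \<longlonglongrightarrow> f x"
    if "limitin (pointwise_top X F) s f sequentially" for f and s :: "nat \<Rightarrow> _"
    using that by (auto simp: pointwise_top_def limitin_subtopology limitin_componentwise)
  then show ?thesis
    using assms(1) that unfolding seq_separable_def top by metis
qed

section \<open>Polynomials with rational coefficients\<close>

text \<open>\<open>D\<close> is the ring generated by the rational constants and the coordinate
  functions; Stone--Weierstrass applies on every compact set, so one countable family serves all
  \<open>K\<close> and \<open>e\<close>.\<close>

lemma countable_dense_continuous:
  obtains D :: "('a::euclidean_space \<Rightarrow> real) set" where "countable D"
    "\<And>d. d \<in> D \<Longrightarrow> continuous_on UNIV d"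
    "\<And>K f e. \<lbrakk>compact K; continuous_on K f; e > 0\<rbrakk> \<Longrightarrow> \<exists>d\<in>D. \<forall>x\<in>K. \<bar>f x - d x\<bar> < e"
proof -
  \<comment> \<open>One round of sums and products; iterating it generates the ring while each stage
    stays countable.\<close>
  define step :: "('a \<Rightarrow> real) set \<Rightarrow> ('a \<Rightarrow> real) set" where
    "step A = A \<union> (\<lambda>(f, g) x. f x + g x) ` (A \<times> A) \<union> (\<lambda>(f, g) x. f x * g x) ` (A \<times> A)" for A
  define L where "L n = (step ^^ n) ((\<lambda>c x. c) ` \<rat> \<union> (\<lambda>b x. x \<bullet> b) ` Basis)" for n
  define D where "D = (\<Union>n. L n)"
  have L0: "L 0 = (\<lambda>c x. c) ` \<rat> \<union> (\<lambda>b x. x \<bullet> b) ` Basis" and LS: "L (Suc n) = step (L n)" for n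
    by (simp_all add: L_def)
  have "countable (L n)" for n
    by (induction n) (auto simp: L0 LS step_def countable_rat countable_finite)
  then have cD: "countable D" by (simp add: D_def)
  have cont: "d \<in> L n \<Longrightarrow> continuous_on UNIV d" for d n
  proof (induction n arbitrary: d)
    case 0 then show ?case by (auto simp: L0 intro!: continuous_intros)
  next
    case (Suc n) then show ?case
      by (auto simp: LS step_def intro!: continuous_intros)
  qed
  have mono: "m \<le> n \<Longrightarrow> L m \<subseteq> L n" for m n
    by (rule lift_Suc_mono_le[of L]) (auto simp: LS step_def)
  have ops: "(\<lambda>x. f x + g x) \<in> D \<and> (\<lambda>x. f x * g x) \<in> D" if fg: "f \<in> D" "g \<in> D" for f g
  proof -
    obtain m n where "f \<in> L m" "g \<in> L n" using fg by (auto simp: D_def)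
    then have "f \<in> L (max m n)" "g \<in> L (max m n)"
      using mono[of m "max m n"] mono[of n "max m n"] by auto
    then have "(\<lambda>x. f x + g x) \<in> L (Suc (max m n)) \<and> (\<lambda>x. f x * g x) \<in> L (Suc (max m n))"
      by (force simp: LS step_def)
    then show ?thesis by (auto simp: D_def)
  qed
  have D0: "(\<lambda>x. c) \<in> D" if "c \<in> \<rat>" for c
    using that by (auto simp: D_def L0 intro!: exI[of _ 0])
  have D1: "(\<lambda>x. x \<bullet> b) \<in> D" if "b \<in> Basis" for b
    using that by (auto simp: D_def L0 intro!: exI[of _ 0])
  have Dcont: "continuous_on K d" if "d \<in> D" for d K
    using that cont by (auto simp: D_def intro: continuous_on_subset)
  have approx: "\<exists>d\<in>D. \<forall>x\<in>K. \<bar>f x - d x\<bar> < e"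
    if K: "compact K" and f: "continuous_on K f" and e: "e > 0" for K f and e :: real
  proof -
    \<comment> \<open>Stone--Weierstrass asks for a ring with all real constants, which the
      countable \<open>D\<close> cannot contain. It is therefore applied to the uniform closure
      \<open>R\<close> of \<open>D\<close> on \<open>K\<close>.\<close>
    define R where "R = {f. continuous_on K f \<and> (\<forall>e>0. \<exists>d\<in>D. \<forall>x\<in>K. \<bar>f x - d x\<bar> < e)}"
    interpret function_ring_on R K
    proof
      show "compact K" by (fact K)
      show "f \<in> R \<Longrightarrow> continuous_on K f" for f by (simp add: R_def)
      fix f g assume f: "f \<in> R" and g: "g \<in> R"
      show "(\<lambda>x. f x + g x) \<in> R"
        unfolding R_def mem_Collect_eq
      proof (intro conjI allI impI)
        show "continuous_on K (\<lambda>x. f x + g x)"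
          using f g by (auto simp: R_def intro!: continuous_intros)
        fix e :: real assume "e > 0"
        then obtain d d' where d: "d \<in> D" "d' \<in> D"
          "\<forall>x\<in>K. \<bar>f x - d x\<bar> < e/2" "\<forall>x\<in>K. \<bar>g x - d' x\<bar> < e/2"
          using f g half_gt_zero[of e] unfolding R_def mem_Collect_eq by metis
        have "\<bar>f x + g x - (d x + d' x)\<bar> < e" if "x \<in> K" for x
          using d(3,4)[rule_format, OF that] by linarith
        then show "\<exists>d\<in>D. \<forall>x\<in>K. \<bar>f x + g x - d x\<bar> < e"
          using ops[OF d(1,2)] by (intro bexI[of _ "\<lambda>x. d x + d' x"]) auto
      qed
      show "(\<lambda>x. f x * g x) \<in> R"
        unfolding R_def mem_Collect_eq
      proof (intro conjI allI impI)
        show "continuous_on K (\<lambda>x. f x * g x)"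
          using f g by (auto simp: R_def intro!: continuous_intros)
        fix e :: real assume "e > 0"
        have "bounded (f ` K)" "bounded (g ` K)"
          using f g K by (auto simp: R_def intro!: compact_imp_bounded compact_continuous_image)
        then obtain A B where AB: "\<forall>x\<in>K. \<bar>f x\<bar> \<le> A" "\<forall>x\<in>K. \<bar>g x\<bar> \<le> B"
          by (auto simp: bounded_iff)
        define M where "M = max 1 (max A B)"
        have M: "M \<ge> 1" "\<bar>f x\<bar> \<le> M" "\<bar>g x\<bar> \<le> M" if "x \<in> K" for x
          using AB that by (force simp: M_def)+
        have M1: "M \<ge> 1" by (simp add: M_def)
        \<comment> \<open>The error of the product will be below
          \<open>\<delta> * (2 * M + 1)\<close>, hence below \<open>\<delta> * (3 * M)\<close> since
          \<open>M \<ge> 1\<close>; the bound \<open>\<delta> \<le> 1\<close> serves to keep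
          \<open>d\<close> below \<open>M + 1\<close>.\<close>
        define \<delta> where "\<delta> = min 1 (e / (3 * M))"
        have "\<delta> > 0" "\<delta> \<le> 1" "\<delta> * (3 * M) \<le> e"
          using \<open>e > 0\<close> M1 by (auto simp: \<delta>_def min_def field_simps)
        then obtain d d' where d: "d \<in> D" "d' \<in> D"
          "\<forall>x\<in>K. \<bar>f x - d x\<bar> < \<delta>" "\<forall>x\<in>K. \<bar>g x - d' x\<bar> < \<delta>"
          using f g by (simp add: R_def) metis
        have "\<bar>f x * g x - d x * d' x\<bar> < e" if "x \<in> K" for x
        proof -
          have a: "\<bar>f x - d x\<bar> < \<delta>" "\<bar>g x - d' x\<bar> < \<delta>" using d that by auto
          have b: "\<bar>d x\<bar> \<le> M + 1" using a M[OF that] \<open>\<delta> \<le> 1\<close> by linarith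
          have "\<bar>f x * g x - d x * d' x\<bar> = \<bar>(f x - d x) * g x + d x * (g x - d' x)\<bar>"
            by (simp add: algebra_simps)
          also have "\<dots> \<le> \<bar>f x - d x\<bar> * \<bar>g x\<bar> + \<bar>d x\<bar> * \<bar>g x - d' x\<bar>"
            by (metis abs_mult abs_triangle_ineq)
          also have "\<dots> \<le> \<bar>f x - d x\<bar> * M + (M + 1) * \<bar>g x - d' x\<bar>"
            using b M[OF that] by (intro add_mono mult_mono) auto
          also have "\<dots> < \<delta> * M + (M + 1) * \<delta>"
            using a M1 by (intro add_strict_mono mult_strict_right_mono mult_strict_left_mono) auto
          also have "\<dots> = \<delta> * (2 * M + 1)" by (simp add: algebra_simps)
          also have "\<dots> \<le> \<delta> * (3 * M)"
            using M1 \<open>\<delta> > 0\<close> by (intro mult_left_mono) auto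
          finally show ?thesis using \<open>\<delta> * (3 * M) \<le> e\<close> by linarith
        qed
        then show "\<exists>d\<in>D. \<forall>x\<in>K. \<bar>f x * g x - d x\<bar> < e"
          using ops[OF d(1,2)] by (intro bexI[of _ "\<lambda>x. d x * d' x"]) auto
      qed
    next
      fix c :: real
      have "\<exists>d\<in>D. \<forall>x\<in>K. \<bar>c - d x\<bar> < e" if "e > 0" for e
      proof -
        obtain q where "q \<in> \<rat>" "c < q" "q < c + e"
          using Rats_dense_in_real[of c "c + e"] \<open>e > 0\<close> by auto
        then show ?thesis by (intro bexI[OF _ D0[of q]]) auto
      qed
      then show "(\<lambda>_. c) \<in> R" by (auto simp: R_def)
    next
      fix x y :: 'a assume "x \<noteq> y"
      then obtain b where b: "b \<in> Basis" "x \<bullet> b \<noteq> y \<bullet> b" using euclidean_eqI by blast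
      have "(\<lambda>x. x \<bullet> b) \<in> R"
        using D1[OF b(1)] by (auto simp: R_def intro!: continuous_intros bexI[of _ "\<lambda>x. x \<bullet> b"])
      then show "\<exists>f\<in>R. f x \<noteq> f y"
        using b(2) by (intro bexI[of _ "\<lambda>x. x \<bullet> b"])
    qed
    obtain g where g: "g \<in> R" "\<forall>x\<in>K. \<bar>f x - g x\<bar> < e/2"
      using Stone_Weierstrass_basic[OF f, of "e/2"] e by auto
    then obtain d where "d \<in> D" "\<forall>x\<in>K. \<bar>g x - d x\<bar> < e/2"
      using half_gt_zero[OF e] unfolding R_def by blast
    with g show ?thesis
      by (intro bexI[of _ d]) (fastforce intro: abs_triangle_half_l simp: abs_minus_commute)+
  qed
  show ?thesis
    using that[of D] cD Dcont approx by blast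
qed

section \<open>The first Baire class relative to a subset of Euclidean space\<close>

text \<open>The approximants are continuous on the whole space, although convergence is asked only
  on \<open>S\<close>; this permits replacing them by members of a family that is dense on compact
  sets.\<close>

definition pw_limit_on :: "'a::topological_space set \<Rightarrow> ('a \<Rightarrow> real) \<Rightarrow> bool" where
  "pw_limit_on S f \<longleftrightarrow>
     (\<exists>g::nat \<Rightarrow> 'a \<Rightarrow> real. (\<forall>n. continuous_on UNIV (g n)) \<and> (\<forall>x\<in>S. (\<lambda>n. g n x) \<longlonglongrightarrow> f x))"

lemma pw_limit_on_add:
  assumes "pw_limit_on S f" "pw_limit_on S g" shows "pw_limit_on S (\<lambda>x. f x + g x)"
proof -
  obtain a b where "\<forall>n. continuous_on UNIV (a n)" "\<forall>x\<in>S. (\<lambda>n. a n x) \<longlonglongrightarrow> f x"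
    "\<forall>n. continuous_on UNIV (b n)" "\<forall>x\<in>S. (\<lambda>n. b n x) \<longlonglongrightarrow> g x"
    using assms by (auto simp: pw_limit_on_def)
  then show ?thesis
    unfolding pw_limit_on_def
    by (intro exI[of _ "\<lambda>n x. a n x + b n x"]) (auto intro!: continuous_intros tendsto_intros)
qed

lemma pw_limit_on_diff:
  assumes "pw_limit_on S f" "pw_limit_on S g" shows "pw_limit_on S (\<lambda>x. f x - g x)"
proof -
  obtain a b where "\<forall>n. continuous_on UNIV (a n)" "\<forall>x\<in>S. (\<lambda>n. a n x) \<longlonglongrightarrow> f x"
    "\<forall>n. continuous_on UNIV (b n)" "\<forall>x\<in>S. (\<lambda>n. b n x) \<longlonglongrightarrow> g x"
    using assms by (auto simp: pw_limit_on_def)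
  then show ?thesis
    unfolding pw_limit_on_def
    by (intro exI[of _ "\<lambda>n x. a n x - b n x"]) (auto intro!: continuous_intros tendsto_intros)
qed

text \<open>A Weierstrass test for the first Baire class: clamp the approximants of the
  \<open>n\<close>-th term to the bound \<open>M n\<close>, take longer and longer partial sums, and
  exchange limit and sum by Tannery's theorem.\<close>

lemma pw_limit_on_series:
  assumes "\<And>n::nat. pw_limit_on S (f n)" "\<And>n x. x \<in> S \<Longrightarrow> \<bar>f n x\<bar> \<le> M n" "summable M"
  shows "pw_limit_on S (\<lambda>x. \<Sum>n. f n x)"
proof (cases "S = {}")
  case True then show ?thesis by (auto simp: pw_limit_on_def intro!: continuous_intros)
next
  case False
  \<comment> \<open>A point of \<open>S\<close> forces the bounds to be nonnegative, so the clamping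
    interval is not empty.\<close>
  then have M0: "M n \<ge> 0" for n using assms(2)[of _ n] by force
  obtain g where g: "\<And>n m. continuous_on UNIV (g n m)"
    "\<And>n x. x \<in> S \<Longrightarrow> (\<lambda>m. g n m x) \<longlonglongrightarrow> f n x"
    using assms(1) unfolding pw_limit_on_def by metis
  \<comment> \<open>The cut-off at \<open>n \<le> m\<close> leaves a finite, hence continuous, sum
    for each \<open>m\<close>. Clamping does not change the limit, as \<open>f n x\<close> already
    lies in the interval.\<close>
  define c where "c n m x = (if n \<le> m then max (- M n) (min (M n) (g n m x)) else 0)" for n m :: nat and x
  have cont: "continuous_on UNIV (\<lambda>x. \<Sum>n. c n m x)" for m
  proof -
    have "(\<lambda>x. \<Sum>n. c n m x) = (\<lambda>x. \<Sum>n\<le>m. max (- M n) (min (M n) (g n m x)))"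
      by (rule ext, subst suminf_finite[of "{..m}"]) (auto simp: c_def)
    then show ?thesis by (simp only:) (intro continuous_intros g)
  qed
  have lim: "(\<lambda>m. \<Sum>n. c n m x) \<longlonglongrightarrow> (\<Sum>n. f n x)" if x: "x \<in> S" for x
  proof -
    have "(\<lambda>m. c n m x) \<longlonglongrightarrow> f n x" for n
    proof -
      have "(\<lambda>m. max (- M n) (min (M n) (g n m x))) \<longlonglongrightarrow> max (- M n) (min (M n) (f n x))"
        by (intro tendsto_intros g x)
      moreover have "max (- M n) (min (M n) (f n x)) = f n x"
        using assms(2)[OF x, of n] by auto
      moreover have "eventually (\<lambda>m. max (- M n) (min (M n) (g n m x)) = c n m x) sequentially"
        using eventually_ge_at_top[of n] by eventually_elim (simp add: c_def)
      ultimately show ?thesis using Lim_transform_eventually by fastforce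
    qed
    moreover have "norm (c n m x) \<le> M n" for n m
      using M0[of n] by (auto simp: c_def)
    ultimately show ?thesis
      using tannerys_theorem[of "\<lambda>n m. c n m x" "\<lambda>n. f n x" sequentially M] assms(3)
      by (auto intro!: always_eventually)
  qed
  show ?thesis unfolding pw_limit_on_def
    using cont lim by (intro exI[of _ "\<lambda>m x. \<Sum>n. c n m x"]) auto
qed

text \<open>The limit is \<open>f 0\<close> plus the telescoping series of differences, whose terms
  are dominated by a geometric series.\<close>

lemma pw_limit_on_uniform_limit:
  assumes "\<And>n::nat. pw_limit_on S (f n)" "\<And>n x. x \<in> S \<Longrightarrow> \<bar>f n x - h x\<bar> \<le> (1/2)^n"
  shows "pw_limit_on S h"
proof -
  have sm: "summable (\<lambda>n. 2 * (1/2)^n :: real)"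
    by (intro summable_mult summable_geometric) simp
  have bd: "\<bar>f (Suc n) x - f n x\<bar> \<le> 2 * (1/2)^n" if "x \<in> S" for x n
  proof -
    have "(1/2)^Suc n \<le> (1/2::real)^n" by simp
    then show ?thesis
      using assms(2)[OF that, of n] assms(2)[OF that, of "Suc n"] by linarith
  qed
  have "(\<lambda>n. f (Suc n) x - f n x) sums (h x - f 0 x)" if "x \<in> S" for x
  proof (rule telescope_sums)
    have "(\<lambda>n. f n x - h x) \<longlonglongrightarrow> 0"
      by (rule Lim_null_comparison[of _ "\<lambda>n. (1/2)^n"])
         (use assms(2)[OF that] in \<open>auto intro!: always_eventually LIMSEQ_power_zero\<close>)
    then show "(\<lambda>n. f n x) \<longlonglongrightarrow> h x" by (simp add: LIM_zero_iff)
  qed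
  then have eq: "f 0 x + (\<Sum>n. f (Suc n) x - f n x) = h x" if "x \<in> S" for x
    using sums_unique that by fastforce
  have "pw_limit_on S (\<lambda>x. f 0 x + (\<Sum>n. f (Suc n) x - f n x))"
    by (intro pw_limit_on_add assms pw_limit_on_series[OF _ bd sm] pw_limit_on_diff)
  then show ?thesis using eq unfolding pw_limit_on_def by simp
qed

text \<open>Exhaust each \<open>B i\<close> by increasing closed sets \<open>C i n\<close>. On the
  finite disjoint union of the \<open>C i n\<close> with \<open>i \<le> n\<close> the step function
  is continuous, and Tietze extends it. At each point of \<open>S\<close> the extensions eventually
  have the exact value.\<close>

lemma pw_limit_on_step:
  fixes B :: "nat \<Rightarrow> 'a::euclidean_space set"
  assumes "\<And>i. fsigma_in euclidean (B i)" "disjoint_family B" "S \<subseteq> (\<Union>i. B i)"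
    and "\<And>i x. x \<in> S \<inter> B i \<Longrightarrow> f x = c i"
  shows "pw_limit_on S f"
proof -
  obtain C where C: "\<And>i n. closed (C i n)" "\<And>i n. C i n \<subseteq> C i (Suc n)" "\<And>i. (\<Union>n. C i n) = B i"
    using assms(1) unfolding fsigma_in_ascending closed_closedin[symmetric] by metis
  define idx where "idx x = (THE i. x \<in> B i)" for x
  have idx: "idx x = i" if "x \<in> B i" for x i
    unfolding idx_def using that assms(2) by (intro the_equality) (auto simp: disjoint_family_on_def)
  have "\<exists>g. continuous_on UNIV g \<and> (\<forall>i\<le>n. \<forall>x\<in>C i n. g x = c i)" for n
  proof -
    have "continuous_on (\<Union>i\<in>{..n}. C i n) (\<lambda>x. c (idx x))"
    proof (rule continuous_on_closed_Union)
      fix i assume "i \<in> {..n}"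
      have "c (idx x) = c i" if "x \<in> C i n" for x using idx[of x i] C(3) that by auto
      then show "continuous_on (C i n) (\<lambda>x. c (idx x))"
        by (auto intro: continuous_on_eq[OF continuous_on_const])
    qed (auto simp: C)
    moreover have "closedin (top_of_set UNIV) (\<Union>i\<in>{..n}. C i n)"
      by (auto intro!: closed_UN C simp flip: closed_closedin)
    ultimately obtain g where g: "continuous_on UNIV g" "\<And>x. x \<in> (\<Union>i\<in>{..n}. C i n) \<Longrightarrow> g x = c (idx x)"
      by (rule Tietze_unbounded) auto
    have "g x = c i" if "i \<le> n" "x \<in> C i n" for i x
      using g(2)[of x] idx[of x i] C(3) that by auto
    with g(1) show ?thesis by blast
  qed
  then obtain g where g: "\<And>n. continuous_on UNIV (g n)" "\<And>n i x. i \<le> n \<Longrightarrow> x \<in> C i n \<Longrightarrow> g n x = c i"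
    by metis
  have mono: "C i m \<subseteq> C i n" if "m \<le> n" for i m n
    by (rule lift_Suc_mono_le[of "C i", OF _ that]) (use C in auto)
  have "(\<lambda>n. g n x) \<longlonglongrightarrow> f x" if x: "x \<in> S" for x
  proof -
    obtain i where "x \<in> B i" using assms(3) x by blast
    moreover obtain m where "x \<in> C i m" using calculation C(3)[of i] by blast
    ultimately have i: "x \<in> B i" "x \<in> C i m" by auto
    have "eventually (\<lambda>n. g n x = f x) sequentially"
      using eventually_ge_at_top[of "max i m"]
    proof eventually_elim
      case (elim n)
      then show ?case using g(2)[of i n x] mono[of m n i] i x assms(4)[of x i] by auto
    qed
    then show ?thesis by (rule tendsto_eventually)
  qed
  then show ?thesis using g(1) by (auto simp: pw_limit_on_def)
qed

text \<open>List the closed pieces of all \<open>A i\<close> in one sequence, subtract from each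
  piece the earlier ones, and regroup the remainders by the index \<open>i\<close> from which they
  came.\<close>

lemma fsigma_in_reduction:
  fixes A :: "nat \<Rightarrow> 'a set"
  assumes "metrizable_space X" "\<And>i. fsigma_in X (A i)"
  obtains B where "\<And>i. fsigma_in X (B i)" "disjoint_family B" "\<And>i. B i \<subseteq> A i"
    "(\<Union>i. B i) = (\<Union>i. A i)"
proof -
  obtain C where C: "\<And>i n. closedin X (C i n)" "\<And>i. (\<Union>n::nat. C i n) = A i"
    using assms(2) unfolding fsigma_in_ascending by metis
  define P where "P k = (case prod_decode k of (i, n) \<Rightarrow> C i n)" for k
  define E where "E k = P k - (\<Union>m<k. P m)" for k
  define B where "B i = (\<Union>n. E (prod_encode (i, n)))" for i
  have P: "closedin X (P k)" for k using C by (auto simp: P_def split: prod.split)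
  \<comment> \<open>Metrizability enters here: closed sets are \<open>G\<^sub>\<delta>\<close>, so
    subtracting finitely many of them from a closed set leaves an \<open>F\<^sub>\<sigma>\<close>
    set.\<close>
  have "gdelta_in X (\<Union>m<k. P m)" for k
    using P assms(1) by (intro closed_imp_gdelta_in closedin_Union) auto
  then have "fsigma_in X (E k)" for k
    unfolding E_def by (intro fsigma_in_diff closed_imp_fsigma_in P)
  then have 1: "fsigma_in X (B i)" for i
    unfolding B_def by (intro fsigma_in_Union) auto
  have E: "k = l" if "x \<in> E k" "x \<in> E l" for x k l
    using that by (cases k l rule: linorder_cases) (auto simp: E_def)
  have 2: "disjoint_family B"
    by (auto simp: disjoint_family_on_def B_def dest: E)
  have 3: "B i \<subseteq> A i" for i
    using C(2)[of i] by (auto simp: B_def E_def P_def)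
  have "x \<in> (\<Union>i. B i)" if x: "x \<in> A i" for x i
  proof -
    obtain n where "x \<in> C i n" using x C(2)[of i] by blast
    then have "x \<in> P (prod_encode (i, n))" by (simp add: P_def)
    then have ex: "\<exists>k. x \<in> P k" by blast
    define k where "k = (LEAST k. x \<in> P k)"
    have "x \<in> P k" unfolding k_def by (rule LeastI_ex[OF ex])
    moreover have "x \<notin> P m" if "m < k" for m using that not_less_Least unfolding k_def by fast
    ultimately have "x \<in> E k" by (simp add: E_def)
    then have "x \<in> B (fst (prod_decode k))"
      unfolding B_def by (intro UN_I[of "snd (prod_decode k)"]) auto
    then show ?thesis by blast
  qed
  with 3 have "(\<Union>i. B i) = (\<Union>i. A i)" by blast
  with 1 2 3 show ?thesis by (rule that)
qed

text \<open>The Lebesgue--Hausdorff theorem, with the extension from \<open>S\<close> built in: disjoint relative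
  \<open>F\<^sub>\<sigma>\<close> subsets of \<open>S\<close> can by reduction be realised as traces of disjoint \<open>F\<^sub>\<sigma>\<close> sets of the whole
  space.\<close>
lemma pw_limit_on_fsigma:
  fixes f :: "'a::euclidean_space \<Rightarrow> real"
  assumes lt: "\<And>r. \<exists>A. fsigma_in euclidean A \<and> {x\<in>S. f x < r} = S \<inter> A"
    and gt: "\<And>r. \<exists>A. fsigma_in euclidean A \<and> {x\<in>S. f x > r} = S \<inter> A"
  shows "pw_limit_on S f"
proof -
  define c :: "nat \<Rightarrow> real" where "c = from_nat_into \<rat>"
  have c: "range c = \<rat>"
    unfolding c_def by (rule range_from_nat_into) (auto simp: countable_rat)
  have step: "\<exists>g. pw_limit_on S g \<and> (\<forall>x\<in>S. \<bar>g x - f x\<bar> \<le> (1/2)^n)" for n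
  proof -
    define e :: real where "e = (1/2)^n"
    have e: "e > 0" by (simp add: e_def)
    obtain A1 A2 where A1: "\<And>r. fsigma_in euclidean (A1 r)" "\<And>r. {x\<in>S. f x < r} = S \<inter> A1 r"
      and A2: "\<And>r. fsigma_in euclidean (A2 r)" "\<And>r. {x\<in>S. f x > r} = S \<inter> A2 r"
      using lt gt by metis
    \<comment> \<open>On \<open>S\<close> this is the set where \<open>f\<close> is within
      \<open>e\<close> of the rational \<open>c i\<close>. Making these sets disjoint selects one
      such rational at each point, which gives a step function \<open>g\<close> close to
      \<open>f\<close>.\<close>
    define A where "A i = A1 (c i + e) \<inter> A2 (c i - e)" for i
    have A: "\<bar>c i - f x\<bar> < e \<longleftrightarrow> x \<in> A i" if "x \<in> S" for x i
    proof -
      have "f x < c i + e \<longleftrightarrow> x \<in> A1 (c i + e)" "f x > c i - e \<longleftrightarrow> x \<in> A2 (c i - e)"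
        using that A1(2)[of "c i + e"] A2(2)[of "c i - e"] by blast+
      then show ?thesis by (auto simp: A_def)
    qed
    have "fsigma_in euclidean (A i)" for i
      unfolding A_def by (intro fsigma_in_Int A1 A2)
    then obtain B where B: "\<And>i. fsigma_in euclidean (B i)" "disjoint_family B" "\<And>i. B i \<subseteq> A i"
      "(\<Union>i. B i) = (\<Union>i. A i)"
      using fsigma_in_reduction[of euclidean A] metrizable_space_euclidean by metis
    have SB: "S \<subseteq> (\<Union>i. B i)"
      unfolding B(4)
    proof
      fix x assume "x \<in> S"
      obtain q where "q \<in> \<rat>" "f x < q" "q < f x + e"
        using Rats_dense_in_real[of "f x" "f x + e"] e by auto
      then obtain i where "c i = q" using c by (metis rangeE)
      then have "\<bar>c i - f x\<bar> < e" using \<open>f x < q\<close> \<open>q < f x + e\<close> by auto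
      then show "x \<in> (\<Union>i. A i)" using A \<open>x \<in> S\<close> by blast
    qed
    define g where "g x = c (THE i. x \<in> B i)" for x
    have g: "g x = c i" if "x \<in> B i" for x i
    proof -
      have "(THE j. x \<in> B j) = i"
        using that B(2) by (intro the_equality) (auto simp: disjoint_family_on_def)
      then show ?thesis by (simp add: g_def)
    qed
    have "pw_limit_on S g"
      using B(1,2) SB by (rule pw_limit_on_step) (use g in auto)
    moreover have "\<bar>g x - f x\<bar> \<le> e" if x: "x \<in> S" for x
    proof -
      obtain i where "x \<in> B i" using x SB by blast
      then show ?thesis using A[OF x, of i] B(3)[of i] g[of x i] by auto
    qed
    ultimately show ?thesis unfolding e_def by blast
  qed
  then obtain g where "\<And>n. pw_limit_on S (g n)" "\<And>n x. x \<in> S \<Longrightarrow> \<bar>g n x - f x\<bar> \<le> (1/2)^n"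
    by metis
  then show ?thesis by (rule pw_limit_on_uniform_limit)
qed

text \<open>Approximate the \<open>n\<close>-th function within \<open>(1/2)^n\<close> on the ball
  of radius \<open>n\<close>; every point lies in all but finitely many of these balls.\<close>

lemma pw_limit_on_dense:
  fixes f :: "'a::euclidean_space \<Rightarrow> real"
  assumes "pw_limit_on S f"
    and D: "\<And>K f e. \<lbrakk>compact K; continuous_on K f; e > 0\<rbrakk> \<Longrightarrow> \<exists>d\<in>D. \<forall>x\<in>K. \<bar>f x - d x\<bar> < (e::real)"
  obtains s where "\<And>n::nat. s n \<in> D" "\<And>x. x \<in> S \<Longrightarrow> (\<lambda>n. s n x) \<longlonglongrightarrow> f x"
proof -
  obtain g where g: "\<And>n. continuous_on UNIV (g n)" "\<And>x. x \<in> S \<Longrightarrow> (\<lambda>n. g n x) \<longlonglongrightarrow> f x"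
    using assms(1) by (auto simp: pw_limit_on_def)
  have "\<exists>d\<in>D. \<forall>x\<in>cball 0 (real n). \<bar>g n x - d x\<bar> < (1/2)^n" for n
    by (rule D) (auto intro: continuous_on_subset[OF g(1)])
  then obtain s where s: "\<And>n. s n \<in> D" "\<And>n x. norm x \<le> real n \<Longrightarrow> \<bar>g n x - s n x\<bar> < (1/2)^n"
    by (metis dist_0_norm mem_cball)
  have "(\<lambda>n. s n x) \<longlonglongrightarrow> f x" if "x \<in> S" for x
  proof -
    have "eventually (\<lambda>n. norm (g n x - s n x) \<le> (1/2)^n) sequentially"
      using eventually_ge_at_top[of "nat \<lceil>norm x\<rceil>"]
    proof eventually_elim
      case (elim n)
      then have "norm x \<le> real n" by linarith
      then show ?case using s(2)[of x n] by auto
    qed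
    then have "(\<lambda>n. g n x - s n x) \<longlonglongrightarrow> 0"
      by (rule Lim_null_comparison) (auto intro!: LIMSEQ_power_zero)
    from tendsto_diff[OF g(2)[OF that] this] show ?thesis by simp
  qed
  with s(1) show ?thesis by (rule that)
qed

text \<open>\<open>S\<close> need not be closed, so the functions \<open>h n\<close> may have no
  continuous extension. Instead the sublevel sets of \<open>f\<close> are shown to be traces of
  \<open>F\<^sub>\<sigma>\<close> sets: \<open>f x < r\<close> iff, for some \<open>k\<close>,
  eventually \<open>h n x \<le> r - inverse (real (Suc k))\<close>.\<close>

lemma pw_limit_on_relative:
  fixes f :: "'a::euclidean_space \<Rightarrow> real"
  assumes h: "\<And>n::nat. continuous_on S (h n)" and lim: "\<And>x. x \<in> S \<Longrightarrow> (\<lambda>n. h n x) \<longlonglongrightarrow> f x"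
  shows "pw_limit_on S f"
proof -
  \<comment> \<open>Stated for arbitrary \<open>h\<close> and \<open>f\<close>, so that superlevel
    sets follow by passing to the negatives.\<close>
  have key: "\<exists>A. fsigma_in euclidean A \<and> {x\<in>S. f x < r} = S \<inter> A"
    if h: "\<And>n::nat. continuous_on S (h n)" and lim: "\<And>x. x \<in> S \<Longrightarrow> (\<lambda>n. h n x) \<longlonglongrightarrow> f x"
    for h :: "nat \<Rightarrow> 'a \<Rightarrow> real" and f r
  proof -
    have "\<exists>T. closed T \<and> S \<inter> T = {x\<in>S. h n x \<le> r - inverse (real (Suc k))}" for n k
    proof -
      have "closedin (top_of_set S) (S \<inter> h n -` {..r - inverse (real (Suc k))})"
        by (intro continuous_closedin_preimage h closed_atMost)
      then obtain T where "closed T" "S \<inter> h n -` {..r - inverse (real (Suc k))} = S \<inter> T"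
        by (auto simp: closedin_closed)
      then show ?thesis by (intro exI[of _ T]) auto
    qed
    then have "\<forall>n k. \<exists>T. closed T \<and> S \<inter> T = {x\<in>S. h n x \<le> r - inverse (real (Suc k))}" by blast
    then obtain T where "\<forall>n k. closed (T n k) \<and> S \<inter> T n k = {x\<in>S. h n x \<le> r - inverse (real (Suc k))}"
      unfolding choice_iff by (elim exE)
    then have T: "\<And>n k. closed (T n k)"
      "\<And>n k. S \<inter> T n k = {x\<in>S. h n x \<le> r - inverse (real (Suc k))}" by blast+
    define A where "A = (\<Union>k. \<Union>m. \<Inter>n\<in>{m..}. T n k)"
    have "fsigma_in euclidean (\<Inter>n\<in>{m..}. T n k)" for m k
      using T(1) by (intro closed_imp_fsigma_in) (simp add: closed_INT flip: closed_closedin)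
    then have "fsigma_in euclidean (\<Union>m. \<Inter>n\<in>{m..}. T n k)" for k
      by (intro fsigma_in_Union) auto
    then have "fsigma_in euclidean A"
      unfolding A_def by (intro fsigma_in_Union) auto
    moreover have "f x < r \<longleftrightarrow> x \<in> A" if x: "x \<in> S" for x
    proof -
      have TT: "x \<in> T n k \<longleftrightarrow> h n x \<le> r - inverse (real (Suc k))" for n k
        using T(2)[of n k] x by blast
      show ?thesis
      proof
        assume "f x < r"
        then obtain k where k: "inverse (real (Suc k)) < r - f x"
          using reals_Archimedean[of "r - f x"] by auto
        then have "f x < r - inverse (real (Suc k))" by simp
        from order_tendstoD(2)[OF lim[OF x] this]
        obtain m where "\<forall>n\<ge>m. h n x < r - inverse (real (Suc k))"
          by (auto simp: eventually_sequentially)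
        then show "x \<in> A" unfolding A_def using TT by (auto intro!: less_imp_le)
      next
        assume "x \<in> A"
        then obtain k m where "\<forall>n\<in>{m..}. x \<in> T n k"
          unfolding A_def by blast
        then have "\<forall>n\<ge>m. h n x \<le> r - inverse (real (Suc k))"
          using TT by simp
        then have "f x \<le> r - inverse (real (Suc k))"
          by (intro LIMSEQ_le_const2[OF lim[OF x]]) auto
        moreover have "inverse (real (Suc k)) > 0" by simp
        ultimately show "f x < r" by linarith
      qed
    qed
    ultimately show ?thesis by blast
  qed
  show ?thesis
  proof (rule pw_limit_on_fsigma)
    fix r
    show "\<exists>A. fsigma_in euclidean A \<and> {x\<in>S. f x < r} = S \<inter> A"
      using key[of h f r] h lim by blast
    have "\<exists>A. fsigma_in euclidean A \<and> {x\<in>S. - f x < - r} = S \<inter> A"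
      by (rule key[of "\<lambda>n x. - h n x" "\<lambda>x. - f x"]) (auto intro!: continuous_intros tendsto_intros h lim)
    then show "\<exists>A. fsigma_in euclidean A \<and> {x\<in>S. f x > r} = S \<inter> A" by simp
  qed
qed

section \<open>The plane with the cone topology\<close>

definition ratq :: "nat \<Rightarrow> real" where
  "ratq = from_nat_into \<rat>"

lemma range_ratq: "range ratq = \<rat>"
  unfolding ratq_def by (rule range_from_nat_into) (auto simp: countable_rat)

text \<open>The value at \<open>(p, ratq n)\<close> is \<open>0 / 0 = 0\<close>, which is also the value on the rest of the
  horizontal line through this point.\<close>
definition cusp :: "real \<times> nat \<Rightarrow> real \<times> real \<Rightarrow> real" where
  "cusp i z = \<bar>snd z - ratq (snd i)\<bar> / (\<bar>fst z - fst i\<bar> + \<bar>snd z - ratq (snd i)\<bar>)"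

lemma cusp_nonneg: "0 \<le> cusp i z" and cusp_le_1: "cusp i z \<le> 1"
  by (auto simp: cusp_def divide_le_eq_1)

text \<open>On the vertical line through its vertex a cusp is the indicator of the complement of the
  vertex; this makes single points visible to continuous functions there.\<close>

lemma cusp_vertical: "cusp (p, n) (p, y) = (if y = ratq n then 0 else 1)"
  by (simp add: cusp_def)

lemma isCont_cusp:
  assumes "z \<noteq> (p, ratq n)"
  shows "isCont (cusp (p, n)) z"
proof -
  have "\<bar>fst z - p\<bar> + \<bar>snd z - ratq n\<bar> \<noteq> 0"
    using assms by (cases z) auto
  then show ?thesis
    unfolding cusp_def by (auto intro!: continuous_intros)
qed

lemma isCont_cusp_horizontal: "isCont (\<lambda>x. cusp (p, n) (x, y)) x0"
proof (cases "y = ratq n")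
  case True then show ?thesis by (simp add: cusp_def)
next
  case False
  then have "\<bar>x0 - p\<bar> + \<bar>y - ratq n\<bar> \<noteq> 0" by auto
  then show ?thesis
    unfolding cusp_def by (auto intro!: continuous_intros)
qed

text \<open>A topology finer than that of the cone plane; every set open in the cone plane
  satisfies this predicate, and only this is used about open sets.\<close>
definition cusp_open :: "(real \<times> real) set \<Rightarrow> bool" where
  "cusp_open U \<longleftrightarrow> (\<forall>x y. (x, y) \<in> U \<longrightarrow>
     (y \<notin> \<rat> \<longrightarrow> (x, y) \<in> interior U) \<and>
     (y \<in> \<rat> \<longrightarrow> eventually (\<lambda>x'. (x', y) \<in> interior U) (at x)))"

lemma istopology_cusp_open: "istopology cusp_open"
  unfolding istopology_def
proof (intro conjI allI impI)
  fix S T assume S: "cusp_open S" and T: "cusp_open T"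
  show "cusp_open (S \<inter> T)"
    unfolding cusp_open_def
  proof (intro allI impI conjI)
    fix x y assume "(x, y) \<in> S \<inter> T" "y \<notin> \<rat>"
    then show "(x, y) \<in> interior (S \<inter> T)" using S T by (simp add: cusp_open_def)
  next
    fix x y assume "(x, y) \<in> S \<inter> T" "y \<in> \<rat>"
    then have "eventually (\<lambda>x'. (x', y) \<in> interior S) (at x)" "eventually (\<lambda>x'. (x', y) \<in> interior T) (at x)"
      using S T by (auto simp: cusp_open_def)
    then show "eventually (\<lambda>x'. (x', y) \<in> interior (S \<inter> T)) (at x)"
      by eventually_elim simp
  qed
next
  fix \<K> assume K: "\<forall>S\<in>\<K>. cusp_open S"
  have sub: "interior S \<subseteq> interior (\<Union>\<K>)" if "S \<in> \<K>" for S
    using that by (intro interior_mono) auto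
  show "cusp_open (\<Union>\<K>)"
    unfolding cusp_open_def
  proof (intro allI impI conjI)
    fix x y assume "(x, y) \<in> \<Union>\<K>" "y \<notin> \<rat>"
    then obtain S where "S \<in> \<K>" "(x, y) \<in> S" by blast
    then show "(x, y) \<in> interior (\<Union>\<K>)"
      using K sub[of S] \<open>y \<notin> \<rat>\<close> by (auto simp: cusp_open_def)
  next
    fix x y assume "(x, y) \<in> \<Union>\<K>" "y \<in> \<rat>"
    then obtain S where S: "S \<in> \<K>" "(x, y) \<in> S" by blast
    then have "eventually (\<lambda>x'. (x', y) \<in> interior S) (at x)"
      using K \<open>y \<in> \<rat>\<close> by (auto simp: cusp_open_def)
    then show "eventually (\<lambda>x'. (x', y) \<in> interior (\<Union>\<K>)) (at x)"
      by (rule eventually_mono) (use sub S in blast)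
  qed
qed

definition cusp_top :: "(real \<times> real) topology" where
  "cusp_top = topology cusp_open"

lemma openin_cusp_top: "openin cusp_top = cusp_open"
  unfolding cusp_top_def by (rule topology_inverse'[OF istopology_cusp_open])

lemma cusp_open_if_open:
  assumes "open U" shows "cusp_open U"
proof -
  have "eventually (\<lambda>x'. (x', y) \<in> U) (at x)" if "(x, y) \<in> U" for x y
  proof -
    have "isCont (\<lambda>x'. (x', y)) x" by (intro continuous_intros)
    then have "((\<lambda>x'. (x', y)) \<longlongrightarrow> (x, y)) (at x)" by (simp add: isCont_def)
    then show ?thesis using assms that by (rule topological_tendstoD)
  qed
  then show ?thesis using assms by (auto simp: cusp_open_def interior_open)
qed

lemma topspace_cusp_top [simp]: "topspace cusp_top = UNIV"
  using openin_subset[of cusp_top UNIV] cusp_open_if_open[of UNIV]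
  by (auto simp: openin_cusp_top)

lemma interior_vimage_isCont:
  assumes "isCont f z" "open V" "f z \<in> V"
  shows "z \<in> interior (f -` V)"
proof -
  have "eventually (\<lambda>w. f w \<in> V) (nhds z)"
    using assms continuous_at_imp_continuous_within filterlim_def
    by (metis isCont_def tendsto_at_iff_tendsto_nhds topological_tendstoD)
  then show ?thesis by (auto simp: eventually_nhds interior_def)
qed

text \<open>A cusp is continuous in the Euclidean sense except at its vertex, whose ordinate is
  rational, and along every horizontal line it is continuous throughout.\<close>

lemma cusp_open_vimage_cusp:
  assumes "open V" shows "cusp_open (cusp i -` V)"
proof -
  obtain p n where i: "i = (p, n)" by (cases i)
  show ?thesis
    unfolding cusp_open_def i
  proof (intro allI impI conjI)
    fix x y assume "(x, y) \<in> cusp (p, n) -` V" "y \<notin> \<rat>"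
    then have "(x, y) \<noteq> (p, ratq n)" using range_ratq by auto
    with \<open>(x, y) \<in> _\<close> show "(x, y) \<in> interior (cusp (p, n) -` V)"
      by (intro interior_vimage_isCont isCont_cusp assms) auto
  next
    fix x y assume "(x, y) \<in> cusp (p, n) -` V"
    then have "eventually (\<lambda>x'. cusp (p, n) (x', y) \<in> V) (at x)"
      using isCont_cusp_horizontal[where p = p and n = n and y = y and ?x0.0 = x] assms
      by (auto simp: isCont_def intro: topological_tendstoD)
    \<comment> \<open>Even for \<open>x = p\<close> the punctured neighbourhood avoids the vertex,
      so the cusp is continuous at all the nearby points \<open>(x', y)\<close>.\<close>
    moreover have "eventually (\<lambda>x'. x' \<noteq> p) (at x)" by (rule eventually_neq_at_within)
    ultimately show "eventually (\<lambda>x'. (x', y) \<in> interior (cusp (p, n) -` V)) (at x)"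
      by eventually_elim (auto intro!: interior_vimage_isCont isCont_cusp assms)
  qed
qed

section \<open>The cone plane as an initial topology\<close>

text \<open>The coarsest topology making the Euclidean coordinates and all cusps continuous. The
  parameter \<open>e\<close> transports it from the plane to another type, since the final space has
  carrier type \<open>real\<close>.\<close>

definition cusp_plane :: "('a \<Rightarrow> real \<times> real) \<Rightarrow> 'a topology" where
  "cusp_plane e = pullback_topology UNIV (\<lambda>t. (e t, \<lambda>i. cusp i (e t)))
     (prod_topology euclidean (product_topology (\<lambda>_. euclideanreal) UNIV))"

lemma topspace_cusp_plane [simp]: "topspace (cusp_plane e) = UNIV"
  by (simp add: cusp_plane_def topspace_pullback_topology)

lemma continuous_map_cusp_plane:
  "continuous_map (cusp_plane e) (prod_topology euclidean (product_topology (\<lambda>_. euclideanreal) UNIV))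
     (\<lambda>t. (e t, \<lambda>i. cusp i (e t)))"
  using continuous_map_pullback[OF continuous_map_id, of UNIV "\<lambda>t. (e t, \<lambda>i. cusp i (e t))"]
  by (simp add: cusp_plane_def id_def comp_def)

lemma continuous_map_cusp_plane_coords: "continuous_map (cusp_plane e) euclidean e"
  using continuous_map_cusp_plane[of e] by (simp add: continuous_map_pairwise comp_def)

lemma continuous_map_cusp_plane_cusp: "continuous_map (cusp_plane e) euclideanreal (\<lambda>t. cusp i (e t))"
  using continuous_map_cusp_plane[of e]
  by (cases i) (simp add: continuous_map_pairwise comp_def continuous_map_componentwise_UNIV)

lemma continuous_map_cusp_plane_comp:
  fixes d :: "real \<times> real \<Rightarrow> real"
  assumes "continuous_on UNIV d"
  shows "continuous_map (cusp_plane e) euclideanreal (\<lambda>t. d (e t))"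
  using continuous_map_compose[OF continuous_map_cusp_plane_coords[of e], of euclideanreal d] assms
  by (simp add: comp_def)

text \<open>For an initial topology it suffices to test the generating functions, namely the
  identity of the plane and the cusps.\<close>

lemma continuous_map_inv_cusp_plane:
  assumes "bij e"
  shows "continuous_map cusp_top (cusp_plane e) (inv e)"
  unfolding cusp_plane_def
proof (rule continuous_map_pullback')
  have "continuous_map cusp_top euclidean (\<lambda>z. z)"
    by (auto simp: continuous_map_def openin_cusp_top intro: cusp_open_if_open)
  moreover have "continuous_map cusp_top euclideanreal (cusp i)" for i
    using cusp_open_vimage_cusp by (auto simp: continuous_map_def openin_cusp_top vimage_def)
  ultimately show "continuous_map cusp_top
      (prod_topology euclidean (product_topology (\<lambda>_. euclideanreal) UNIV))
      ((\<lambda>t. (e t, \<lambda>i. cusp i (e t))) \<circ> inv e)"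
    using assms by (simp add: continuous_map_pairwise comp_def continuous_map_componentwise_UNIV
        surj_f_inv_f bij_is_surj)
qed auto

lemma cusp_open_if_openin_cusp_plane:
  assumes "bij e" "openin (cusp_plane e) U"
  shows "cusp_open (inv e -` U)"
  using continuous_map_inv_cusp_plane[OF assms(1)] assms(2)
  by (auto simp: continuous_map_def openin_cusp_top vimage_def)

text \<open>The generating functions embed the space into a product of Euclidean factors,
  injectively because \<open>e\<close> is their first component; both properties pass to products
  and subspaces.\<close>

lemma Tychonoff_cusp_plane:
  assumes "bij e"
  shows "Tychonoff_space (cusp_plane e)"
proof -
  define P :: "((real \<times> real) \<times> (real \<times> nat \<Rightarrow> real)) topology"
    where "P = prod_topology euclidean (product_topology (\<lambda>_. euclideanreal) UNIV)"
  define F where "F t = (e t, \<lambda>i. cusp i (e t))" for t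
  have inj: "inj F" using assms by (auto simp: F_def inj_def bij_def)
  have X: "cusp_plane e = pullback_topology UNIV F P" by (simp add: cusp_plane_def P_def F_def[abs_def])
  have "homeomorphic_maps (cusp_plane e) (subtopology P (range F)) F (inv F)"
    unfolding homeomorphic_maps_def
  proof (intro conjI ballI)
    show "continuous_map (cusp_plane e) (subtopology P (range F)) F"
      using continuous_map_cusp_plane[of e]
      by (simp add: continuous_map_in_subtopology P_def F_def[abs_def])
    have "continuous_map (subtopology P (range F)) P (F \<circ> inv F)"
      by (rule continuous_map_eq[OF continuous_map_from_subtopology[OF continuous_map_id]])
         (auto simp: f_inv_into_f)
    then show "continuous_map (subtopology P (range F)) (cusp_plane e) (inv F)"
      unfolding X by (rule continuous_map_pullback') auto
  qed (auto simp: inj f_inv_into_f)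
  then have h: "cusp_plane e homeomorphic_space subtopology P (range F)"
    by (auto simp: homeomorphic_space_def)
  have "completely_regular_space P" "Hausdorff_space P"
    unfolding P_def
    by (auto simp: completely_regular_space_prod_topology completely_regular_space_product_topology
        Hausdorff_space_prod_topology Hausdorff_space_product_topology metrizable_imp_completely_regular_space metrizable_space_euclidean)
  then show ?thesis
    unfolding Tychonoff_space_def
      homeomorphic_completely_regular_space[OF h] homeomorphic_Hausdorff_space[OF h]
    by (simp add: completely_regular_space_subtopology Hausdorff_space_subtopology)
qed

section \<open>Euclidean description of the new open sets\<close>

lemma cusp_open_horizontal:
  assumes "cusp_open U" "q \<in> \<rat>"
  shows "open {x. (x, q) \<in> U}"
proof (subst open_subopen, intro ballI)
  fix x assume "x \<in> {x. (x, q) \<in> U}"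
  then have x: "(x, q) \<in> U" by simp
  then have "eventually (\<lambda>x'. (x', q) \<in> interior U) (at x)"
    using assms by (auto simp: cusp_open_def)
  then have "eventually (\<lambda>x'. (x', q) \<in> U) (at x)"
    by (rule eventually_mono) (use interior_subset in blast)
  with x have "eventually (\<lambda>x'. (x', q) \<in> U) (nhds x)"
    by (simp add: eventually_nhds_conv_at)
  then show "\<exists>T. open T \<and> x \<in> T \<and> T \<subseteq> {x. (x, q) \<in> U}"
    by (auto simp: eventually_nhds)
qed

lemma closed_horizontal: "closed {z :: real \<times> real. snd z = q}"
  by (intro closed_Collect_eq continuous_intros)

text \<open>Outside its interior such a set has only points on the countably many rational
  horizontal lines, and its trace on each of these closed lines is relatively open.\<close>

lemma cusp_open_fsigma:
  assumes "cusp_open U"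
  shows "fsigma_in euclidean U"
proof -
  have op: "fsigma_in euclidean V" if "open V" for V :: "(real \<times> real) set"
    using that open_imp_fsigma_in metrizable_space_euclidean open_openin by blast
  define L where "L q = {z. snd z = q} \<inter> fst -` {x. (x, q) \<in> U}" for q
  have "U = interior U \<union> (\<Union>q\<in>\<rat>. L q)"
    using assms interior_subset by (fastforce simp: L_def cusp_open_def)
  moreover have "fsigma_in euclidean (L q)" if "q \<in> \<rat>" for q
    unfolding L_def using closed_horizontal cusp_open_horizontal[OF assms that]
    by (intro fsigma_in_Int op closed_imp_fsigma_in open_vimage continuous_intros)
       (simp_all flip: closed_closedin)
  then have "fsigma_in euclidean (\<Union>q\<in>\<rat>. L q)"
    by (intro fsigma_in_Union) (auto simp: countable_rat)
  ultimately show ?thesis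
    using fsigma_in_Un op open_interior by metis
qed

text \<open>Points of irrational ordinate in a new open set are interior, so the Euclidean interior
  has the same trace.\<close>

lemma cusp_continuous_on_irrational:
  fixes g :: "real \<times> real \<Rightarrow> 'b::topological_space"
  assumes "\<And>V. open V \<Longrightarrow> cusp_open (g -` V)"
  shows "continuous_on {z. snd z \<notin> \<rat>} g"
  unfolding continuous_on_open_invariant
proof (intro allI impI)
  fix B :: "'b set" assume "open B"
  then have "cusp_open (g -` B)" by (rule assms)
  then have "interior (g -` B) \<inter> {z. snd z \<notin> \<rat>} = g -` B \<inter> {z. snd z \<notin> \<rat>}"
    using interior_subset by (fastforce simp: cusp_open_def)
  then show "\<exists>A. open A \<and> A \<inter> {z. snd z \<notin> \<rat>} = g -` B \<inter> {z. snd z \<notin> \<rat>}"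
    using open_interior by blast
qed

lemma cusp_continuous_on_horizontal:
  fixes g :: "real \<times> real \<Rightarrow> 'b::topological_space"
  assumes "\<And>V. open V \<Longrightarrow> cusp_open (g -` V)" "q \<in> \<rat>"
  shows "continuous_on {z. snd z = q} g"
  unfolding continuous_on_open_invariant
proof (intro allI impI)
  fix B :: "'b set" assume "open B"
  then have "open {x. (x, q) \<in> g -` B}"
    by (intro cusp_open_horizontal assms)
  then have "open (fst -` {x. (x, q) \<in> g -` B} :: (real \<times> real) set)"
    by (intro open_vimage continuous_intros)
  then show "\<exists>A. open A \<and> A \<inter> {z. snd z = q} = g -` B \<inter> {z. snd z = q}"
    by (intro exI[of _ "fst -` {x. (x, q) \<in> g -` B}"]) auto
qed

lemma cusp_open_vimage:
  assumes "bij e" "continuous_map (cusp_plane e) euclideanreal g" "open V"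
  shows "cusp_open ((\<lambda>z. g (inv e z)) -` V)"
proof -
  have "openin (cusp_plane e) (g -` V)"
    using assms(2,3) by (auto simp: continuous_map_def vimage_def)
  from cusp_open_if_openin_cusp_plane[OF assms(1) this] show ?thesis
    by (simp add: vimage_def)
qed

section \<open>Sequential separability of \<open>Cp\<close> and \<open>B1\<close>\<close>

text \<open>Preimages of open sets under continuous functions are \<open>F\<^sub>\<sigma>\<close> in
  the plane, so Lebesgue--Hausdorff applies with \<open>S = UNIV\<close>.\<close>

lemma seq_separable_Cp_cusp_plane:
  assumes "bij e"
  shows "seq_separable (Cp (cusp_plane e))"
proof -
  obtain D :: "(real \<times> real \<Rightarrow> real) set" where D: "countable D" "\<And>d. d \<in> D \<Longrightarrow> continuous_on UNIV d"
    "\<And>K f e. \<lbrakk>compact K; continuous_on K f; e > 0\<rbrakk> \<Longrightarrow> \<exists>d\<in>D. \<forall>x\<in>K. \<bar>f x - d x\<bar> < e"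
    by (rule countable_dense_continuous) blast
  show ?thesis
    unfolding Cp_def
  proof (rule seq_separable_pointwise_topI)
    show "(\<lambda>d t. d (e t)) ` D \<subseteq> {f. f \<in> extensional (topspace (cusp_plane e)) \<and>
        continuous_map (cusp_plane e) euclideanreal f}"
      using D(2) by (auto intro: continuous_map_cusp_plane_comp)
    show "countable ((\<lambda>d t. d (e t)) ` D)" using D(1) by simp
    fix f assume "f \<in> {f. f \<in> extensional (topspace (cusp_plane e)) \<and>
        continuous_map (cusp_plane e) euclideanreal f}"
    then have f: "continuous_map (cusp_plane e) euclideanreal f" by simp
    define g where "g z = f (inv e z)" for z
    have "fsigma_in euclidean (g -` V)" if "open V" for V
      using cusp_open_fsigma[OF cusp_open_vimage[OF assms f that]] by (simp add: g_def[abs_def])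
    from this[of "{..<_}"] this[of "{_<..}"] have "pw_limit_on UNIV g"
      by (intro pw_limit_on_fsigma) (auto simp: vimage_def)
    then obtain s where s: "\<And>n::nat. s n \<in> D" "\<And>z. (\<lambda>n. s n z) \<longlonglongrightarrow> g z"
      by (rule pw_limit_on_dense[OF _ D(3)]) auto
    have "g (e t) = f t" for t using assms by (simp add: g_def bij_def)
    then have "(\<lambda>n. s n (e t)) \<longlonglongrightarrow> f t" for t
      using s(2)[of "e t"] by simp
    with s(1) show "\<exists>s. (\<forall>n::nat. s n \<in> (\<lambda>d t. d (e t)) ` D) \<and>
        (\<forall>x\<in>topspace (cusp_plane e). (\<lambda>n. s n x) \<longlonglongrightarrow> f x)"
      by (intro exI[of _ "\<lambda>n t. s n (e t)"]) simp
  qed auto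
qed

text \<open>Finite lists as codes for the modified lines keep the family of modifications
  countable.\<close>

fun patch :: "(real \<times> (real \<times> real \<Rightarrow> real)) list \<Rightarrow> (real \<times> real \<Rightarrow> real) \<Rightarrow> real \<times> real \<Rightarrow> real" where
  "patch [] a z = a z"
| "patch ((q, d) # l) a z = (if snd z = q then d z else patch l a z)"

text \<open>The overriding function depends only on the ordinate, so repeated entries cannot
  conflict.\<close>

lemma patch_map:
  "patch (map (\<lambda>i. (r i, B (r i))) xs) a z = (if snd z \<in> r ` set xs then B (snd z) z else a z)"
  by (induction xs) auto

lemma pw_limit_on_patch:
  assumes "continuous_on UNIV a" "\<And>q d. (q, d) \<in> set l \<Longrightarrow> continuous_on UNIV d"
  shows "pw_limit_on UNIV (patch l a)"
  using assms(2)
proof (induction l)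
  case Nil
  show ?case using assms(1) by (auto simp: pw_limit_on_def)
next
  case (Cons y l)
  obtain q d where y: "y = (q, d)" by (cases y)
  obtain h where h: "\<And>n. continuous_on UNIV (h n)" "\<And>z. (\<lambda>n. h n z) \<longlonglongrightarrow> patch l a z"
    using Cons by (auto simp: pw_limit_on_def)
  have d: "continuous_on UNIV d" using Cons.prems y by auto
  \<comment> \<open>The tent factor is 1 on the line \<open>snd z = q\<close> and, at each point off
    the line, is 0 for all large \<open>n\<close>.\<close>
  define k where "k n z = h n z + max 0 (1 - real n * \<bar>snd z - q\<bar>) * (d z - h n z)" for n z
  have "continuous_on UNIV (k n)" for n
    unfolding k_def by (intro continuous_intros h d)
  moreover have "(\<lambda>n. k n z) \<longlonglongrightarrow> patch (y # l) a z" for z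
  proof (cases "snd z = q")
    case True then show ?thesis by (simp add: k_def y)
  next
    case False
    then obtain N where N: "real N * \<bar>snd z - q\<bar> > 1"
      using reals_Archimedean3[of "\<bar>snd z - q\<bar>"] by auto
    have "eventually (\<lambda>n. h n z = k n z) sequentially"
      using eventually_ge_at_top[of N]
    proof eventually_elim
      case (elim n)
      then have "real n * \<bar>snd z - q\<bar> \<ge> real N * \<bar>snd z - q\<bar>"
        by (intro mult_right_mono) auto
      then show ?case using N by (simp add: k_def max_def)
    qed
    with h(2)[of z] show ?thesis
      using False by (simp add: y) (rule Lim_transform_eventually)
  qed
  ultimately show ?case by (auto simp: pw_limit_on_def)
qed

lemma seq_separable_B1_cusp_plane:
  assumes "bij e"
  shows "seq_separable (B1 (cusp_plane e))"
proof -
  obtain D :: "(real \<times> real \<Rightarrow> real) set" where D: "countable D" "\<And>d. d \<in> D \<Longrightarrow> continuous_on UNIV d"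
    "\<And>K f e. \<lbrakk>compact K; continuous_on K f; e > 0\<rbrakk> \<Longrightarrow> \<exists>d\<in>D. \<forall>x\<in>K. \<bar>f x - d x\<bar> < e"
    by (rule countable_dense_continuous) blast
  define F where "F = {f. f \<in> extensional (topspace (cusp_plane e)) \<and>
    (\<exists>g::nat \<Rightarrow> 'a \<Rightarrow> real. (\<forall>n. continuous_map (cusp_plane e) euclideanreal (g n)) \<and>
       (\<forall>x\<in>topspace (cusp_plane e). (\<lambda>n. g n x) \<longlonglongrightarrow> f x))}"
  define E where "E = (\<lambda>(l, a) t. patch l a (e t)) ` (lists (\<rat> \<times> D) \<times> D)"
  show ?thesis
    unfolding B1_def F_def[symmetric]
  proof (rule seq_separable_pointwise_topI)
    show "countable E"
      using D(1) by (auto simp: E_def countable_rat)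
    show "E \<subseteq> F"
    proof
      fix f assume "f \<in> E"
      then obtain l a where la: "l \<in> lists (\<rat> \<times> D)" "a \<in> D" "f = (\<lambda>t. patch l a (e t))"
        by (auto simp: E_def)
      then have "pw_limit_on UNIV (patch l a)"
        by (intro pw_limit_on_patch) (auto intro: D(2))
      then obtain g where g: "\<And>n. continuous_on UNIV (g n)" "\<And>z. (\<lambda>n. g n z) \<longlonglongrightarrow> patch l a z"
        by (auto simp: pw_limit_on_def)
      have "continuous_map (cusp_plane e) euclideanreal (\<lambda>t. g n (e t))" for n
        by (rule continuous_map_cusp_plane_comp[OF g(1)])
      moreover have "(\<lambda>n. g n (e t)) \<longlonglongrightarrow> patch l a (e t)" for t by (rule g(2))
      ultimately show "f \<in> F"
        unfolding F_def la(3) mem_Collect_eq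
        by (intro conjI exI[of _ "\<lambda>n t. g n (e t)"]) simp_all
    qed
    show "F \<subseteq> extensional (topspace (cusp_plane e))" by (auto simp: F_def)
    fix f assume "f \<in> F"
    then obtain g where g: "\<And>n. continuous_map (cusp_plane e) euclideanreal (g n)"
      "\<And>t. (\<lambda>n. g n t) \<longlonglongrightarrow> f t"
      by (auto simp: F_def)
    define h where "h n z = g n (inv e z)" for n z
    define f' where "f' z = f (inv e z)" for z
    have h: "cusp_open (h n -` V)" if "open V" for n V
      using cusp_open_vimage[OF assms g(1) that] by (simp add: h_def[abs_def])
    have lim: "(\<lambda>n. h n z) \<longlonglongrightarrow> f' z" for z
      unfolding h_def f'_def by (rule g)
    \<comment> \<open>The plane is cut into the points of irrational ordinate and the rational
      horizontal lines; on each piece the \<open>h n\<close> are continuous in the Euclidean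
      sense.\<close>
    have "pw_limit_on {z. snd z \<notin> \<rat>} f'"
      by (rule pw_limit_on_relative[OF cusp_continuous_on_irrational[OF h] lim])
    then obtain a where a: "\<And>n::nat. a n \<in> D" "\<And>z. snd z \<notin> \<rat> \<Longrightarrow> (\<lambda>n. a n z) \<longlonglongrightarrow> f' z"
      by (rule pw_limit_on_dense[OF _ D(3)]) auto
    have "\<exists>b. (\<forall>n::nat. b n \<in> D) \<and> (\<forall>z. snd z = q \<longrightarrow> (\<lambda>n. b n z) \<longlonglongrightarrow> f' z)" if "q \<in> \<rat>" for q
    proof -
      have "pw_limit_on {z. snd z = q} f'"
        by (rule pw_limit_on_relative[OF cusp_continuous_on_horizontal[OF h that] lim])
      then obtain b where "\<And>n::nat. b n \<in> D" "\<And>z. snd z = q \<Longrightarrow> (\<lambda>n. b n z) \<longlonglongrightarrow> f' z"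
        by (rule pw_limit_on_dense[OF _ D(3)]) auto
      then show ?thesis by blast
    qed
    then have "\<forall>q\<in>\<rat>. \<exists>b. (\<forall>n::nat. b n \<in> D) \<and> (\<forall>z. snd z = q \<longrightarrow> (\<lambda>n. b n z) \<longlonglongrightarrow> f' z)"
      by blast
    then obtain b where "\<forall>q\<in>\<rat>. (\<forall>n::nat. b q n \<in> D) \<and> (\<forall>z. snd z = q \<longrightarrow> (\<lambda>n. b q n z) \<longlonglongrightarrow> f' z)"
      unfolding bchoice_iff by (elim exE)
    then have b: "\<And>q n. q \<in> \<rat> \<Longrightarrow> b q n \<in> D"
      "\<And>z. snd z \<in> \<rat> \<Longrightarrow> (\<lambda>n. b (snd z) n z) \<longlonglongrightarrow> f' z"
      by blast+
    \<comment> \<open>The \<open>m\<close>-th function uses the approximants of the first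
      \<open>m\<close> rational lines and \<open>a m\<close> elsewhere; each point is eventually
      treated by the sequence of its own piece.\<close>
    define l where "l m = map (\<lambda>i. (ratq i, b (ratq i) m)) [0..<m]" for m
    have rq: "ratq i \<in> \<rat>" for i using range_ratq by auto
    have l: "l m \<in> lists (\<rat> \<times> D)" for m
      using b(1) rq by (auto simp: l_def)
    have patch: "patch (l m) (a m) z = (if snd z \<in> ratq ` {..<m} then b (snd z) m z else a m z)" for m z
      using patch_map[of ratq "\<lambda>q. b q m" "[0..<m]" "a m" z] by (simp add: l_def atLeast0LessThan)
    have conv: "(\<lambda>m. patch (l m) (a m) z) \<longlonglongrightarrow> f' z" for z
    proof (cases "snd z \<in> \<rat>")
      case False
      then have "snd z \<notin> ratq ` {..<m}" for m using rq by auto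
      then show ?thesis using a(2)[OF False] by (simp add: patch)
    next
      case True
      then obtain i where i: "snd z = ratq i" using range_ratq by (metis rangeE)
      have "eventually (\<lambda>m. b (snd z) m z = patch (l m) (a m) z) sequentially"
        using eventually_gt_at_top[of i] by eventually_elim (auto simp: patch i)
      with b(2)[OF True] show ?thesis by (rule Lim_transform_eventually)
    qed
    have "f' (e t) = f t" for t using assms by (simp add: f'_def bij_def)
    then have "(\<lambda>m. patch (l m) (a m) (e t)) \<longlonglongrightarrow> f t" for t
      using conv[of "e t"] by simp
    moreover have "(\<lambda>t. patch (l m) (a m) (e t)) \<in> E" for m
      unfolding E_def using l a(1) by (intro image_eqI[of _ _ "(l m, a m)"]) auto
    ultimately show "\<exists>s. (\<forall>n::nat. s n \<in> E) \<and>
        (\<forall>x\<in>topspace (cusp_plane e). (\<lambda>n. s n x) \<longlonglongrightarrow> f x)"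
      by (intro exI[of _ "\<lambda>m t. patch (l m) (a m) (e t)"]) auto
  qed
qed

section \<open>Upper semicontinuous functions\<close>

text \<open>Each isolated point is singled out by a basic open set, which injects \<open>E\<close>
  into a countable basis.\<close>

lemma countable_if_isolated_points:
  fixes E :: "'a::second_countable_topology set"
  assumes "\<And>x. x \<in> E \<Longrightarrow> \<not> x islimpt E"
  shows "countable E"
proof -
  obtain \<B> :: "'a set set" where B: "countable \<B>" "topological_basis \<B>"
    using ex_countable_basis by blast
  have "\<exists>T\<in>\<B>. T \<inter> E = {x}" if x: "x \<in> E" for x
  proof -
    obtain U where U: "open U" "x \<in> U" "\<And>y. y \<in> E \<Longrightarrow> y \<in> U \<Longrightarrow> y = x"
      using assms[OF x] by (auto simp: islimpt_def)
    obtain T where T: "T \<in> \<B>" "x \<in> T" "T \<subseteq> U"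
      using topological_basisE[OF B(2) U(1,2)] by blast
    have "T \<inter> E = {x}"
    proof (intro equalityI subsetI)
      fix y assume "y \<in> T \<inter> E"
      then have "y = x" using T(3) by (intro U(3)) auto
      then show "y \<in> {x}" by simp
    qed (use x T(2) in simp)
    with T(1) show ?thesis by (rule bexI[rotated])
  qed
  then obtain T where T: "\<And>x. x \<in> E \<Longrightarrow> T x \<in> \<B>" "\<And>x. x \<in> E \<Longrightarrow> T x \<inter> E = {x}"
    by metis
  have "inj_on T E" by (rule inj_onI) (metis T(2) singleton_inject)
  moreover have "countable (T ` E)"
    by (rule countable_subset[OF _ B(1)]) (use T(1) in auto)
  ultimately show ?thesis by (rule countable_image_inj_on[rotated])
qed

text \<open>On a single rational line the exceptional points are isolated from each other, because
  the nearby points of that line are interior.\<close>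

lemma countable_cusp_open_exceptions:
  assumes "cusp_open U"
  shows "countable {x. \<exists>q\<in>\<rat>. (x, q) \<in> U - interior U}"
proof -
  have "countable {x. (x, q) \<in> U - interior U}" if q: "q \<in> \<rat>" for q
  proof (rule countable_if_isolated_points)
    fix x assume "x \<in> {x. (x, q) \<in> U - interior U}"
    then have "eventually (\<lambda>x'. (x', q) \<in> interior U) (at x)"
      using assms q by (auto simp: cusp_open_def)
    then have "eventually (\<lambda>x'. x' \<notin> {x. (x, q) \<in> U - interior U}) (at x)"
      by (rule eventually_mono) simp
    then show "\<not> x islimpt {x. (x, q) \<in> U - interior U}"
      by (simp add: islimpt_iff_eventually)
  qed
  then have "countable (\<Union>q\<in>\<rat>. {x. (x, q) \<in> U - interior U})"
    by (simp add: countable_rat)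
  moreover have "(\<Union>q\<in>\<rat>. {x. (x, q) \<in> U - interior U}) = {x. \<exists>q\<in>\<rat>. (x, q) \<in> U - interior U}"
    by blast
  ultimately show ?thesis by simp
qed

text \<open>Otherwise the sets \<open>G n\<close> and the complements of single rationals would be
  countably many dense open sets with empty intersection, against Baire's theorem.\<close>

lemma rationals_not_gdelta:
  fixes G :: "nat \<Rightarrow> real set"
  assumes "\<And>n. open (G n)"
  shows "\<rat> \<noteq> (\<Inter>n. G n)"
proof
  assume eq: "\<rat> = (\<Inter>n. G n)"
  define \<G> where "\<G> = range G \<union> (\<lambda>q. - {q}) ` \<rat>"
  have "UNIV \<subseteq> closure (\<Inter>\<G>)"
  proof (rule Baire)
    show "countable \<G>" by (auto simp: \<G>_def countable_rat)
    fix T assume "T \<in> \<G>"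
    then consider n where "T = G n" | q where "T = - {q}" by (auto simp: \<G>_def)
    then show "openin (top_of_set UNIV) T \<and> UNIV \<subseteq> closure T"
    proof cases
      case 1
      then have "\<rat> \<subseteq> T" using eq by auto
      then have "closure \<rat> \<subseteq> closure T" by (rule closure_mono)
      then show ?thesis using 1 assms by (simp add: Rats_closure_real)
    next
      case 2 then show ?thesis by (auto simp: closure_complement)
    qed
  qed auto
  moreover have "\<Inter>\<G> = {}"
  proof -
    have "x \<in> \<rat>" if "x \<in> \<Inter>\<G>" for x
      unfolding eq using that by (auto simp: \<G>_def)
    moreover have "x \<notin> \<rat>" if "x \<in> \<Inter>\<G>" for x
      using that by (auto simp: \<G>_def)
    ultimately show ?thesis by blast
  qed
  ultimately show False by simp
qed

lemma cozero_set_cusp_plane: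
  "cozero_set (cusp_plane e) {t. \<not> (fst (e t) = p \<and> snd (e t) \<notin> \<rat>)}"
proof -
  \<comment> \<open>On the line \<open>fst z = p\<close> the factor \<open>1 - cusp\<close> is the
    indicator of the ordinate \<open>ratq n\<close>, so the sum of the \<open>u n\<close> vanishes
    exactly at the irrational ordinates. The weights \<open>(1/2)^n\<close> make it converge
    uniformly, and the term \<open>\<bar>fst (e t) - p\<bar>\<close> in \<open>g\<close> excludes
    the points off the line.\<close>
  define u where "u n t = (1/2)^n * (1 - cusp (p, n) (e t))" for n t
  define g where "g t = \<bar>fst (e t) - p\<bar> + (\<Sum>n. u n t)" for t
  have u0: "u n t \<ge> 0" for n t
    unfolding u_def using cusp_le_1[of "(p, n)" "e t"] by (intro mult_nonneg_nonneg) simp_all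
  have "u n t \<le> (1/2)^n" for n t
    unfolding u_def using cusp_nonneg[of "(p, n)" "e t"] by (intro mult_left_le) simp_all
  with u0 have u1: "norm (u n t) \<le> (1/2)^n" for n t
    by (metis abs_of_nonneg real_norm_def)
  have sg: "summable (\<lambda>n. (1/2)^n :: real)" by (intro summable_geometric) simp
  have su: "summable (\<lambda>n. u n t)" for t
    by (rule summable_comparison_test'[OF sg u1])
  have ul: "uniform_limit UNIV (\<lambda>n t. \<Sum>i<n. u i t) (\<lambda>t. \<Sum>n. u n t) sequentially"
    by (rule Weierstrass_m_test[OF u1 sg])
  have cu: "continuous_map (cusp_plane e) euclideanreal (u n)" for n
    unfolding u_def
    by (intro continuous_map_real_mult continuous_map_diff continuous_map_cusp_plane_cusp) auto
  have "continuous_map (cusp_plane e) Met_TC.mtopology (\<lambda>t. \<Sum>n. u n t)"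
  proof (rule Met_TC.continuous_map_uniform_limit)
    show "\<forall>\<^sub>F n in sequentially. continuous_map (cusp_plane e) Met_TC.mtopology (\<lambda>t. \<Sum>i<n. u i t)"
      using cu by (auto intro!: always_eventually continuous_map_sum)
    fix \<epsilon> :: real assume "\<epsilon> > 0"
    from uniform_limitD[OF ul this]
    show "\<forall>\<^sub>F n in sequentially. \<forall>t\<in>topspace (cusp_plane e). (\<Sum>n. u n t) \<in> UNIV \<and>
        dist (\<Sum>i<n. u i t) (\<Sum>n. u n t) < \<epsilon>"
      by simp
  qed auto
  then have "continuous_map (cusp_plane e) euclideanreal (\<lambda>t. \<Sum>n. u n t)" by simp
  moreover have "continuous_map (cusp_plane e) euclideanreal (\<lambda>t. \<bar>fst (e t) - p\<bar>)"
    by (rule continuous_map_cusp_plane_comp[of "\<lambda>z. \<bar>fst z - p\<bar>"]) (intro continuous_intros)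
  ultimately have cg: "continuous_map (cusp_plane e) euclideanreal g"
    unfolding g_def by (intro continuous_map_add)
  have "g t = 0 \<longleftrightarrow> fst (e t) = p \<and> snd (e t) \<notin> \<rat>" for t
  proof -
    have s0: "(\<Sum>n. u n t) \<ge> 0" using su u0 by (rule suminf_nonneg)
    then have "g t = 0 \<longleftrightarrow> fst (e t) = p \<and> (\<Sum>n. u n t) = 0" by (auto simp: g_def)
    also have "(\<Sum>n. u n t) = 0 \<longleftrightarrow> (\<forall>n. u n t = 0)"
      using suminf_eq_zero_iff[OF su u0] by auto
    also have "fst (e t) = p \<and> (\<forall>n. u n t = 0) \<longleftrightarrow> fst (e t) = p \<and> (\<forall>n. snd (e t) \<noteq> ratq n)"
    proof -
      have "u n t = 0 \<longleftrightarrow> snd (e t) \<noteq> ratq n" if "fst (e t) = p" for n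
        using cusp_vertical[of p n "snd (e t)"] that by (cases "e t") (auto simp: u_def)
      then show ?thesis by auto
    qed
    also have "(\<forall>n. snd (e t) \<noteq> ratq n) \<longleftrightarrow> snd (e t) \<notin> \<rat>"
      unfolding range_ratq[symmetric] by auto
    finally show ?thesis .
  qed
  with cg show ?thesis
    unfolding cozero_set_def by (intro exI[of _ g]) auto
qed

lemma not_seq_separable_USCf_cusp_plane:
  assumes "bij e"
  shows "\<not> seq_separable (USCf_p (cusp_plane e))"
proof
  define F where "F = {f. f \<in> extensional (topspace (cusp_plane e)) \<and>
    (\<forall>r::real. cozero_set (cusp_plane e) {x \<in> topspace (cusp_plane e). f x < r})}"
  assume "seq_separable (USCf_p (cusp_plane e))"
  then have "seq_separable (pointwise_top (cusp_plane e) F)" by (simp add: USCf_p_def F_def)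
  then obtain D where D: "D \<subseteq> F" "countable D" "\<And>f. f \<in> F \<Longrightarrow>
      \<exists>s. (\<forall>n::nat. s n \<in> D) \<and> (\<forall>x\<in>topspace (cusp_plane e). (\<lambda>n. s n x) \<longlonglongrightarrow> f x)"
    by (rule seq_separable_pointwise_topD) (auto simp: F_def)
  \<comment> \<open>The threshold 1/2 separates the two values of the indicator \<open>f\<close> to
    be approximated later.\<close>
  define U where "U d = inv e -` {t. d t < 1/2}" for d :: "'a \<Rightarrow> real"
  have U: "cusp_open (U d)" if "d \<in> D" for d
  proof -
    have "cozero_set (cusp_plane e) {t. d t < 1/2}"
    proof -
      have "\<forall>r. cozero_set (cusp_plane e) {t. d t < r}"
        using that D(1) by (auto simp: F_def)
      then show ?thesis by blast
    qed
    then obtain g where g: "continuous_map (cusp_plane e) euclideanreal g" "{t. d t < 1/2} = {t. g t \<noteq> 0}"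
      by (auto simp: cozero_set_def)
    have "cusp_open ((\<lambda>z. g (inv e z)) -` (- {0}))"
      by (rule cusp_open_vimage[OF assms g(1)]) auto
    then show ?thesis unfolding U_def g(2) by (simp add: vimage_def)
  qed
  define C where "C = (\<Union>d\<in>D. {x. \<exists>q\<in>\<rat>. (x, q) \<in> U d - interior (U d)})"
  have "countable C"
    unfolding C_def using D(2) U countable_cusp_open_exceptions by (intro countable_UN) auto
  then obtain p where p: "p \<notin> C"
    using uncountable_UNIV_real by (metis UNIV_eq_I)
  \<comment> \<open>By the choice of \<open>p\<close> no exceptional point of any \<open>U d\<close>
    lies on this vertical line, so there \<open>U d\<close> has the same trace as its Euclidean
    interior.\<close>
  have int: "(p, y) \<in> interior (U d) \<longleftrightarrow> (p, y) \<in> U d" if "d \<in> D" for d y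
    using p that U[OF that] interior_subset[of "U d"]
    by (cases "y \<in> \<rat>") (auto simp: C_def cusp_open_def)
  define f where "f t = (if fst (e t) = p \<and> snd (e t) \<notin> \<rat> then 1 else 0 :: real)" for t
  have "cozero_set (cusp_plane e) {t. f t < r}" for r
  proof -
    consider "r \<le> 0" | "0 < r" "r \<le> 1" | "1 < r" by linarith
    then show ?thesis
    proof cases
      case 1
      then have "{t. f t < r} = {}" by (auto simp: f_def)
      then show ?thesis by (auto simp: cozero_set_def intro!: exI[of _ "\<lambda>_. 0"])
    next
      case 2
      then have "{t. f t < r} = {t. \<not> (fst (e t) = p \<and> snd (e t) \<notin> \<rat>)}" by (auto simp: f_def)
      then show ?thesis using cozero_set_cusp_plane[of e p] by simp
    next
      case 3
      then have "{t. f t < r} = UNIV" by (auto simp: f_def)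
      then show ?thesis by (auto simp: cozero_set_def intro!: exI[of _ "\<lambda>_. 1"])
    qed
  qed
  then have "f \<in> F" by (simp add: F_def)
  then obtain s where s: "\<And>n::nat. s n \<in> D" "\<And>t. (\<lambda>n. s n t) \<longlonglongrightarrow> f t"
    using D(3)[of f] by auto
  define W where "W n = {y. (p, y) \<in> interior (U (s n))}" for n
  have oW: "open (W n)" for n
  proof -
    have "W n = (\<lambda>y. (p, y)) -` interior (U (s n))" by (auto simp: W_def)
    then show ?thesis by (simp) (intro open_vimage continuous_intros open_interior)
  qed
  have W: "y \<in> W n \<longleftrightarrow> s n (inv e (p, y)) < 1/2" for y n
    using int[OF s(1)] by (simp add: W_def U_def)
  \<comment> \<open>Convergence to the indicator puts rational ordinates into all but finitely many
    \<open>W n\<close> and irrational ones into only finitely many; the limsup of open sets is a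
    \<open>G\<^sub>\<delta>\<close> set.\<close>
  have "y \<in> \<rat> \<longleftrightarrow> (\<forall>m. \<exists>n\<ge>m. y \<in> W n)" for y
  proof (cases "y \<in> \<rat>")
    case True
    have "f (inv e (p, y)) < 1/2"
      using True assms by (simp add: f_def bij_is_surj surj_f_inv_f)
    from order_tendstoD(2)[OF s(2) this] obtain N where "\<forall>n\<ge>N. y \<in> W n"
      by (auto simp: W eventually_sequentially)
    then have "\<exists>n\<ge>m. y \<in> W n" for m by (intro exI[of _ "max m N"]) auto
    with True show ?thesis by simp
  next
    case False
    have "f (inv e (p, y)) > 1/2"
      using False assms by (simp add: f_def bij_is_surj surj_f_inv_f)
    from order_tendstoD(1)[OF s(2) this] obtain N where "\<forall>n\<ge>N. s n (inv e (p, y)) > 1/2"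
      by (auto simp: eventually_sequentially)
    then have "\<not> (\<exists>n\<ge>N. y \<in> W n)" by (force simp: W)
    with False show ?thesis by blast
  qed
  then have "\<rat> = (\<Inter>m. \<Union>n\<in>{m..}. W n)" by (auto simp: Bex_def)
  moreover have "\<rat> \<noteq> (\<Inter>m. \<Union>n\<in>{m..}. W n)"
    by (rule rationals_not_gdelta) (auto intro: oW)
  ultimately show False by simp
qed

text \<open>An infinite set is equipotent with its square; the bijection carries the cone plane over
  to the type \<open>real\<close>.\<close>

lemma ex_bij_real_plane: "\<exists>e :: real \<Rightarrow> real \<times> real. bij e"
proof -
  have "(card_of (UNIV \<times> UNIV :: (real \<times> real) set), card_of (UNIV :: real set)) \<in> ordIso"
    by (rule card_of_Times_same_infinite) (rule infinite_UNIV_char_0)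
  then obtain h where "bij_betw h (UNIV \<times> UNIV :: (real \<times> real) set) (UNIV :: real set)"
    using card_of_ordIso by blast
  then have "bij (inv h)" by (simp add: bij_imp_bij_inv)
  then show ?thesis by blast
qed

theorem theorem3p7:
  shows "\<exists>X :: real topology. Tychonoff_space X \<and> seq_separable (Cp X) \<and>
           seq_separable (B1 X) \<and> \<not> seq_separable (USCf_p X)"
proof -
  obtain e :: "real \<Rightarrow> real \<times> real" where "bij e" using ex_bij_real_plane by blast
  then show ?thesis
    using Tychonoff_cusp_plane seq_separable_Cp_cusp_plane seq_separable_B1_cusp_plane
      not_seq_separable_USCf_cusp_plane by blast
qed

end
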